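(* Let $(X,\Sigma)$ be a measurable space and let $\mu$ be a stationary probability measure on $(X^\infty,\Sigma^\infty)$, i.e. $\mu$ is preserved by the shift $\mathfrak{S}:X^\infty\to X^\infty$, $(x_0,x_1,x_2,\ldots)\mapsto(x_1,x_2,\ldots)$. Then $$H^{ip}(\mu)=H^{sh}(\mathfrak{S},\mu).$$
   Context: Let $(X,\Sigma)$ be a measurable space; $X^\infty=\prod_{n=0}^\infty X$ carries the product $\sigma$-algebra $\Sigma^\infty$. A partition of a measurable space is a finite collection of pairwise disjoint measurable sets whose union is the whole space. For a probability measure $\nu$ and a partition $\mathcal{P}=\{A_i\}_{i=1}^k$, the Shannon entropy is $H^{sh}(\nu,\mathcal{P})=-\sum_{i=1}^k\nu(A_i)\log\nu(A_i)$ (with $0\log 0=0$). For partitions, $\mathcal{P}\vee\mathcal{Q}=\{A_i\cap B_j\}_{i,j}$. For a measurable transformation $T$ of a probability space preserving the probability measure $\nu$, $H^{sh}(T,\nu,\mathcal{P})=\lim_{n\to\infty}\frac1n H^{sh}(\nu,\bigvee_{i=0}^{n-1}T^{-i}\mathcal{P})$ and $H^{sh}(T,\nu)=\sup_{\mathcal{P}}H^{sh}(T,\nu,\mathcal{P})$, the supremum over all partitions of the space on which $T$ acts. For $A_0,\ldots,A_{n-1}\in\Sigma$ put $\overline{A_0\cdots A_{n-1}}=A_0\times\cdots\times A_{n-1}\times X\times X\times\cdots\subseteq X^\infty$; for a partition $\mathcal{P}=\{A_i\}_{i\in I}$ of $X$ let $\overline{\mathcal{P}}^n=\{\overline{A_{i_0}\cdots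 A_{i_{n-1}}}:i_0,\ldots,i_{n-1}\in I\}$, a partition of $X^\infty$. For a probability measure $\mu$ on $(X^\infty,\Sigma^\infty)$, the infinite-product entropy is defined by $H^{ip}(\mu,\mathcal{P})=\limsup_{n\to\infty}\frac1n H^{sh}(\mu,\overline{\mathcal{P}}^n)$ and $H^{ip}(\mu)=\sup_{\mathcal{P}}H^{ip}(\mu,\mathcal{P})\in[0,\infty]$, the supremum over all partitions $\mathcal{P}$ of $X$. *)

theory Defs
  imports "HOL-Probability.Probability"
begin

text \<open>A partition may contain the empty set. As families of sets, partitions carry no
  multiplicities; only empty cells could be repeated, and those contribute nothing to entropy.\<close>

definition finite_partition :: "'a measure \<Rightarrow> 'a set set \<Rightarrow> bool" where
  "finite_partition M P \<longleftrightarrow> finite P \<and> P \<subseteq> sets M \<and> disjoint P \<and> \<Union>P = space M"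

text \<open>Natural logarithm; null cells contribute \<open>0\<close> because \<open>0 * ln 0 = 0\<close>.\<close>

definition shannon_entropy :: "'a measure \<Rightarrow> 'a set set \<Rightarrow> real" where
  "shannon_entropy N P = - (\<Sum>A\<in>P. measure N A * ln (measure N A))"

definition partition_join :: "'a set set \<Rightarrow> 'a set set \<Rightarrow> 'a set set" where
  "partition_join P Q = {A \<inter> B | A B. A \<in> P \<and> B \<in> Q}"

definition partition_vimage :: "'a measure \<Rightarrow> ('a \<Rightarrow> 'a) \<Rightarrow> 'a set set \<Rightarrow> 'a set set" where
  "partition_vimage M T P = {T -` A \<inter> space M | A. A \<in> P}"

text \<open>The join of \<open>T\<^sup>-\<^sup>i P\<close> over \<open>i < n\<close>; the empty join is the trivial partition.\<close>

primrec iterated_join :: "'a measure \<Rightarrow> ('a \<Rightarrow> 'a) \<Rightarrow> 'a set set \<Rightarrow> nat \<Rightarrow> 'a set set" where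
  "iterated_join M T P 0 = {space M}"
| "iterated_join M T P (Suc n) =
     partition_join (iterated_join M T P n) (partition_vimage M (T ^^ n) P)"

definition measure_preserving_map :: "'a measure \<Rightarrow> ('a \<Rightarrow> 'a) \<Rightarrow> bool" where
  "measure_preserving_map M T \<longleftrightarrow> T \<in> measurable M M \<and> distr M M T = M"

text \<open>The limit exists whenever \<open>T\<close> preserves the probability measure \<open>N\<close>; otherwise
  \<^const>\<open>lim\<close> may be unspecified.\<close>

definition sh_entropy_wrt :: "('a \<Rightarrow> 'a) \<Rightarrow> 'a measure \<Rightarrow> 'a set set \<Rightarrow> ereal" where
  "sh_entropy_wrt T N P =
     lim (\<lambda>n. ereal (1 / real n * shannon_entropy N (iterated_join N T P n)))"

definition sh_entropy :: "('a \<Rightarrow> 'a) \<Rightarrow> 'a measure \<Rightarrow> ereal" where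
  "sh_entropy T N = (SUP P\<in>{P. finite_partition N P}. sh_entropy_wrt T N P)"

text \<open>Points of the infinite product are functions on \<^typ>\<open>nat\<close>. Below, \<open>M\<close> stands for the
  measurable space \<open>(X, \<Sigma>)\<close>: only its space and its measurable sets are used, not its measure.\<close>

definition cylinder :: "'a measure \<Rightarrow> nat \<Rightarrow> (nat \<Rightarrow> 'a set) \<Rightarrow> (nat \<Rightarrow> 'a) set" where
  "cylinder M n A = (\<Pi>\<^sub>E i\<in>UNIV. if i < n then A i else space M)"

definition cylinder_partition :: "'a measure \<Rightarrow> 'a set set \<Rightarrow> nat \<Rightarrow> (nat \<Rightarrow> 'a) set set" where
  "cylinder_partition M P n = {cylinder M n A | A. \<forall>i<n. A i \<in> P}"

definition ip_entropy_wrt :: "'a measure \<Rightarrow> (nat \<Rightarrow> 'a) measure \<Rightarrow> 'a set set \<Rightarrow> ereal" where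
  "ip_entropy_wrt M \<mu> P =
     limsup (\<lambda>n. ereal (1 / real n * shannon_entropy \<mu> (cylinder_partition M P n)))"

definition ip_entropy :: "'a measure \<Rightarrow> (nat \<Rightarrow> 'a) measure \<Rightarrow> ereal" where
  "ip_entropy M \<mu> = (SUP P\<in>{P. finite_partition M P}. ip_entropy_wrt M \<mu> P)"

definition seq_shift :: "(nat \<Rightarrow> 'a) \<Rightarrow> nat \<Rightarrow> 'a" where
  "seq_shift x = (\<lambda>n. x (Suc n))"

end

theory Submission
  imports Defs "HOL-Real_Asymp.Real_Asymp"
begin

text \<open>A finite partition \<open>P\<close> of \<open>X\<close>, pulled back along \<open>x \<mapsto> x\<^sub>0\<close>, is a partition of \<open>X\<^sup>\<infinity>\<close> whose
  iterated joins under the shift are exactly the cylinder partitions of \<open>P\<close>; together with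
  Fekete's lemma this makes the infinite-product entropy the supremum of the Kolmogorov-Sinai
  entropies over such pulled-back partitions only. For an arbitrary partition \<open>Q\<close> and any \<open>R\<close>,
  strong subadditivity bounds the entropy rate of \<open>Q\<close> by that of \<open>R\<close> plus \<open>H(Q | R)\<close>. The events
  whose indicator has arbitrarily small conditional entropy given some cylinder partition form
  a \<open>\<sigma>\<close>-algebra (continuity of \<open>t log t\<close> handles countable unions) containing the generators of
  \<open>\<Sigma>\<^sup>\<infinity>\<close>, so \<open>H(Q | R)\<close> can be made arbitrarily small with \<open>R\<close> a cylinder partition.

  Partitions are replaced throughout by simple functions with the same fibres, which gives
  access to the library's entropy of random variables.\<close>

section \<open>Entropy of simple functions\<close>

context information_space
begin

lemma entropy_simple_function:
  assumes "simple_function M X"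
  shows "\<H>(X) = - (\<Sum>v\<in>X ` space M. prob (X -` {v} \<inter> space M) * log b (prob (X -` {v} \<inter> space M)))"
  by (rule entropy_simple_distributed[OF simple_distributedI[OF assms]]) auto

text \<open>Data processing: \<open>Y\<close> factors through \<open>X\<close> on
  \<open>space M\<close>, and \<open>h\<close> is the factor map, built from a chosen representative
  of each fibre. This replaces all reasoning about refinement of partitions.\<close>

lemma entropy_mono:
  assumes X: "simple_function M X"
    and determines: "\<And>x y. x \<in> space M \<Longrightarrow> y \<in> space M \<Longrightarrow> X x = X y \<Longrightarrow> Y x = Y y"
  shows "\<H>(Y) \<le> \<H>(X)"
proof -
  define h where "h v = Y (SOME x. x \<in> space M \<and> X x = v)" for v
  have h: "h (X x) = Y x" if x: "x \<in> space M" for x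
  proof -
    have "(SOME y. y \<in> space M \<and> X y = X x) \<in> space M \<and> X (SOME y. y \<in> space M \<and> X y = X x) = X x"
      by (rule someI[of _ x]) (use x in simp)
    then show ?thesis
      unfolding h_def using determines x by blast
  qed
  have "\<H>(Y) = \<H>(h \<circ> X)"
    \<comment> \<open>\<open>Y\<close> and \<open>h \<circ> X\<close> agree only on
      \<open>space M\<close>, but entropy sees a function only through its image and
      distribution.\<close>
    unfolding entropy_def
    by (intro arg_cong[where f=uminus] arg_cong2[where f="KL_divergence b"] distr_cong
          arg_cong[where f=count_space] image_cong refl) (simp_all add: h)
  then show ?thesis using entropy_data_processing[OF X] by metis
qed

text \<open>Groups the values of \<open>X\<close> by their image under \<open>h\<close>; within a
  group the probabilities add up to that of one fibre of the composition.\<close>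

lemma sum_marginal:
  fixes \<phi> :: "'c \<Rightarrow> real"
  assumes X: "simple_function M X"
  shows "(\<Sum>v\<in>X ` space M. prob (X -` {v} \<inter> space M) * \<phi> (h v)) =
    (\<Sum>w\<in>(\<lambda>x. h (X x)) ` space M. prob ((\<lambda>x. h (X x)) -` {w} \<inter> space M) * \<phi> w)"
proof -
  have fin: "finite (X ` space M)" using X by (rule simple_functionD)
  have "(\<Sum>v\<in>X ` space M. prob (X -` {v} \<inter> space M) * \<phi> (h v)) =
    (\<Sum>w\<in>h ` X ` space M. \<Sum>v\<in>{v \<in> X ` space M. h v = w}. prob (X -` {v} \<inter> space M) * \<phi> (h v))"
    by (rule sum.image_gen[OF fin])
  also have "\<dots> = (\<Sum>w\<in>h ` X ` space M. prob ((\<lambda>x. h (X x)) -` {w} \<inter> space M) * \<phi> w)"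
  proof (rule sum.cong[OF refl])
    fix w
    have "prob ((\<lambda>x. h (X x)) -` {w} \<inter> space M) =
        prob (\<Union>v\<in>{v \<in> X ` space M. h v = w}. X -` {v} \<inter> space M)"
      by (rule arg_cong[where f=prob]) auto
    also have "\<dots> = (\<Sum>v\<in>{v \<in> X ` space M. h v = w}. prob (X -` {v} \<inter> space M))"
      by (rule finite_measure_finite_Union)
        (use fin simple_functionD(2)[OF X] in \<open>auto simp: disjoint_family_on_def\<close>)
    finally show "(\<Sum>v\<in>{v \<in> X ` space M. h v = w}. prob (X -` {v} \<inter> space M) * \<phi> (h v)) =
        prob ((\<lambda>x. h (X x)) -` {w} \<inter> space M) * \<phi> w"
      by (simp add: sum_distrib_right)
  qed
  finally show ?thesis by (simp add: image_image)
qed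

text \<open>Different marginals of one joint variable thereby become sums over the same index set
  and can be combined term by term.\<close>

lemma entropy_marginal:
  assumes X: "simple_function M X"
  shows "\<H>(\<lambda>x. h (X x)) = - (\<Sum>v\<in>X ` space M. prob (X -` {v} \<inter> space M) *
    log b (prob ((\<lambda>x. h (X x)) -` {h v} \<inter> space M)))"
  unfolding sum_marginal[OF X, where h=h and \<phi>="\<lambda>w. log b (prob ((\<lambda>x. h (X x)) -` {w} \<inter> space M))"]
  by (rule entropy_simple_function) (use simple_function_compose1[OF X] in auto)

text \<open>This is nonnegativity of the conditional mutual information of \<open>X\<close> and
  \<open>Y\<close> given \<open>Z\<close>: splitting the logarithm in its formula leaves the four
  entropies.\<close>

lemma entropy_strong_subadditive:
  assumes X: "simple_function M X" and Y: "simple_function M Y" and Z: "simple_function M Z"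
  shows "\<H>(\<lambda>x. (X x, Y x, Z x)) + \<H>(Z) \<le> \<H>(\<lambda>x. (X x, Z x)) + \<H>(\<lambda>x. (Y x, Z x))"
proof -
  let ?W = "\<lambda>x. (X x, Y x, Z x)"
  note XZ = simple_function_Pair[OF X Z] and YZ = simple_function_Pair[OF Y Z]
  note W = simple_function_Pair[OF X YZ]
  note sd = simple_distributedI[OF _ measure_nonneg refl]
  have "0 \<le> (\<Sum>(x, y, z)\<in>?W ` space M. prob (?W -` {(x,y,z)} \<inter> space M) *
     log b (prob (?W -` {(x,y,z)} \<inter> space M) / (prob ((\<lambda>x. (X x, Z x)) -` {(x,z)} \<inter> space M) *
       (prob ((\<lambda>x. (Y x, Z x)) -` {(y,z)} \<inter> space M) / prob (Z -` {z} \<inter> space M)))))"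
    using conditional_mutual_information_nonneg[OF X Y Z]
    unfolding conditional_mutual_information_eq[OF sd[OF Z] sd[OF YZ] sd[OF XZ] sd[OF W]] .
  \<comment> \<open>Each term is written through a projection of \<open>v\<close>, the form in which
    \<open>entropy_marginal\<close> recognises it.\<close>
  also have "\<dots> = (\<Sum>v\<in>?W ` space M.
      prob (?W -` {v} \<inter> space M) * log b (prob (?W -` {id v} \<inter> space M))
    + prob (?W -` {v} \<inter> space M) * log b (prob (Z -` {(snd \<circ> snd) v} \<inter> space M))
    - prob (?W -` {v} \<inter> space M) * log b (prob ((\<lambda>x. (X x, Z x)) -` {(\<lambda>(x,y,z). (x,z)) v} \<inter> space M))
    - prob (?W -` {v} \<inter> space M) * log b (prob ((\<lambda>x. (Y x, Z x)) -` {snd v} \<inter> space M)))"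
  proof (rule sum.cong[OF refl], clarsimp simp del: vimage_Int, goal_cases)
    case (1 \<omega>)
    let ?A = "?W -` {?W \<omega>} \<inter> space M"
    let ?B = "(\<lambda>x. (X x, Z x)) -` {(X \<omega>, Z \<omega>)} \<inter> space M"
    let ?C = "(\<lambda>x. (Y x, Z x)) -` {(Y \<omega>, Z \<omega>)} \<inter> space M"
    let ?D = "Z -` {Z \<omega>} \<inter> space M"
    show ?case
    \<comment> \<open>A null atom contributes zero to both sides. Otherwise the three marginal
      events contain \<open>?A\<close>, so every factor is positive and the logarithm
      splits.\<close>
    proof (cases "prob ?A = 0")
      case False
      then have "prob ?A > 0" by (simp add: zero_less_measure_iff)
      moreover have "prob ?A \<le> prob ?B" "prob ?A \<le> prob ?C" "prob ?A \<le> prob ?D"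
        using simple_functionD(2)[OF XZ] simple_functionD(2)[OF YZ] simple_functionD(2)[OF Z]
        by (auto intro!: finite_measure_mono)
      ultimately have "prob ?A > 0" "prob ?B > 0" "prob ?C > 0" "prob ?D > 0" by auto
      then show ?thesis
        by (simp add: log_mult log_divide algebra_simps)
    qed simp
  qed
  also have "\<dots> = \<H>(\<lambda>x. (X x, Z x)) + \<H>(\<lambda>x. (Y x, Z x)) - \<H>(?W) - \<H>(Z)"
  proof -
    note marg = entropy_marginal[OF W]
    have "\<H>(?W) = - (\<Sum>v\<in>?W ` space M.
        prob (?W -` {v} \<inter> space M) * log b (prob (?W -` {id v} \<inter> space M)))"
      using marg[of id] by (simp only: id_apply)
    moreover have "\<H>(Z) = - (\<Sum>v\<in>?W ` space M.
        prob (?W -` {v} \<inter> space M) * log b (prob (Z -` {(snd \<circ> snd) v} \<inter> space M)))"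
      using marg[of "snd \<circ> snd"] by (simp only: comp_apply snd_conv)
    moreover have "\<H>(\<lambda>x. (X x, Z x)) = - (\<Sum>v\<in>?W ` space M. prob (?W -` {v} \<inter> space M) *
        log b (prob ((\<lambda>x. (X x, Z x)) -` {(\<lambda>(x,y,z). (x,z)) v} \<inter> space M)))"
      using marg[of "\<lambda>(x,y,z). (x,z)"] by (simp only: prod.case)
    moreover have "\<H>(\<lambda>x. (Y x, Z x)) = - (\<Sum>v\<in>?W ` space M. prob (?W -` {v} \<inter> space M) *
        log b (prob ((\<lambda>x. (Y x, Z x)) -` {snd v} \<inter> space M)))"
      using marg[of snd] by (simp only: snd_conv)
    ultimately show ?thesis
      unfolding sum.distrib sum_subtractf by linarith
  qed
  finally show ?thesis by simp
qed

text \<open>Conditional entropy as a difference, so that inequalities between joint entropies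
  combine by linear arithmetic.\<close>

abbreviation cond_entropy :: "('a \<Rightarrow> 'b) \<Rightarrow> ('a \<Rightarrow> 'c) \<Rightarrow> real" where
  "cond_entropy X Y \<equiv> \<H>(\<lambda>x. (X x, Y x)) - \<H>(Y)"

lemma entropy_subadditive:
  assumes X: "simple_function M X" and Y: "simple_function M Y"
  shows "\<H>(\<lambda>x. (X x, Y x)) \<le> \<H>(X) + \<H>(Y)"
  using entropy_chain_rule[OF X Y] conditional_entropy_less_eq_entropy[OF Y X] by simp

end

section \<open>Entropy rates\<close>

text \<open>Fekete's lemma. The limit is the infimum \<open>L\<close> of the quotients; for the
  upper bound, \<open>n\<close> is divided with remainder by an \<open>m\<close> whose quotient is
  close to \<open>L\<close>.\<close>

lemma fekete_subadditive:
  fixes a :: "nat \<Rightarrow> real"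
  assumes nonneg: "\<And>n. 0 \<le> a n" and subadd: "\<And>m n. a (m + n) \<le> a m + a n"
  shows "convergent (\<lambda>n. a n / real n)"
proof -
  define L where "L = (INF n\<in>{1..}. a n / real n)"
  have bdd: "bdd_below ((\<lambda>n. a n / real n) ` {1..})"
    by (rule bdd_belowI2[of _ 0]) (use nonneg in auto)
  have L_le: "L \<le> a n / real n" if "n \<ge> 1" for n
    unfolding L_def by (rule cINF_lower[OF bdd]) (use that in auto)
  have mult: "a (q * m) \<le> a 0 + real q * a m" for q m
  proof (induction q)
    case (Suc q)
    then show ?case using subadd[of m "q * m"] by (simp add: algebra_simps)
  qed simp
  have "(\<lambda>n. a n / real n) \<longlonglongrightarrow> L"
  proof (rule order_tendstoI)
    fix y assume "y < L"
    then show "\<forall>\<^sub>F n in sequentially. y < a n / real n"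
      using L_le by (intro eventually_sequentiallyI[of 1]) force
  next
    fix y assume "L < y"
    then obtain m where m: "m \<ge> 1" "a m / real m < y"
      unfolding L_def by (subst (asm) cINF_less_iff) (use bdd in auto)
    \<comment> \<open>The error of the division: one \<open>a 0\<close> from each of the two uses of
      \<open>mult\<close>, and at most \<open>real m * a 1\<close> for the remainder.\<close>
    define C where "C = 2 * a 0 + real m * a 1"
    have bound: "a n / real n \<le> a m / real m + C / real n" if n: "n \<ge> 1" for n
    proof -
      have "a n \<le> a ((n div m) * m) + a (n mod m)"
        using subadd[of "(n div m) * m" "n mod m"] by simp
      also have "\<dots> \<le> (a 0 + real (n div m) * a m) + (a 0 + real (n mod m) * a 1)"
        using mult[of "n div m" m] mult[of "n mod m" 1] by simp
      also have "real (n mod m) * a 1 \<le> real m * a 1"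
        using m nonneg by (intro mult_right_mono) (auto simp: less_imp_le)
      also have "real (n div m) * a m \<le> real n / real m * a m"
        using nonneg of_nat_div_le_of_nat[of n m] by (intro mult_right_mono) auto
      finally have "a n \<le> real n * (a m / real m) + C"
        by (simp add: C_def)
      then show ?thesis using n by (simp add: field_simps)
    qed
    have "(\<lambda>n. a m / real m + C / real n) \<longlonglongrightarrow> a m / real m + 0"
      by (intro tendsto_intros lim_const_over_n)
    then have "\<forall>\<^sub>F n in sequentially. a m / real m + C / real n < y"
      using m(2) by (intro order_tendstoD) auto
    then show "\<forall>\<^sub>F n in sequentially. a n / real n < y"
      using eventually_ge_at_top[of 1] by eventually_elim (use bound in force)
  qed
  then show ?thesis by (rule convergentI)
qed

section \<open>Partitions as simple functions\<close>

definition cell :: "'a set set \<Rightarrow> 'a \<Rightarrow> 'a set set" where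
  "cell P x = {A \<in> P. x \<in> A}"

lemma cell_eq_iff: "cell P x = cell P y \<longleftrightarrow> (\<forall>A\<in>P. x \<in> A \<longleftrightarrow> y \<in> A)"
  by (auto simp: cell_def)

lemma simple_function_cell:
  assumes P: "finite P" "P \<subseteq> sets M"
  shows "simple_function M (cell P)"
  unfolding simple_function_def
proof (intro conjI ballI)
  show "finite (cell P ` space M)"
    by (rule finite_subset[of _ "Pow P"]) (use P in \<open>auto simp: cell_def\<close>)
  fix c
  show "cell P -` {c} \<inter> space M \<in> sets M"
  proof (cases "c \<subseteq> P")
    case True
    then have "cell P x = c \<longleftrightarrow> (\<forall>A\<in>P. x \<in> A \<longleftrightarrow> A \<in> c)" for x
      unfolding cell_def set_eq_iff by blast
    then have "cell P -` {c} \<inter> space M = {x \<in> space M. \<forall>A\<in>P. x \<in> A \<longleftrightarrow> A \<in> c}"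
      by auto
    also have "\<dots> \<in> sets M"
    proof (rule sets.sets_Collect_finite_All[OF _ P(1)])
      fix A assume "A \<in> P"
      then have "A \<in> sets M" using P by auto
      then show "{x \<in> space M. (x \<in> A) = (A \<in> c)} \<in> sets M"
        by (cases "A \<in> c") (simp_all add: sets.sets_Collect_neg)
    qed
    finally show ?thesis .
  next
    case False
    then have "cell P -` {c} \<inter> space M = {}" by (auto simp: cell_def)
    then show ?thesis by simp
  qed
qed

lemma finite_partition_join:
  assumes "finite_partition M P" "finite_partition M Q"
  shows "finite_partition M (partition_join P Q)"
proof -
  have eq: "partition_join P Q = (\<lambda>(A, B). A \<inter> B) ` (P \<times> Q)"
    by (auto simp: partition_join_def)
  have "disjoint (partition_join P Q)"
    using assms unfolding finite_partition_def partition_join_def disjoint_def by blast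
  moreover have "\<Union> (partition_join P Q) = \<Union>P \<inter> \<Union>Q"
    by (auto simp: partition_join_def)
  moreover have "finite (partition_join P Q)"
    unfolding eq using assms by (auto simp: finite_partition_def)
  moreover have "partition_join P Q \<subseteq> sets M"
    using assms by (auto simp: finite_partition_def partition_join_def)
  ultimately show ?thesis
    using assms by (simp add: finite_partition_def)
qed

lemma cell_partition_join:
  assumes "finite_partition M P" "finite_partition M Q" "x \<in> space M" "y \<in> space M"
  shows "cell (partition_join P Q) x = cell (partition_join P Q) y \<longleftrightarrow>
    cell P x = cell P y \<and> cell Q x = cell Q y"
proof -
  \<comment> \<open>Covering lets each factor be recovered from the join: if \<open>x\<close> lies
    in \<open>A\<close> and in a cell \<open>B\<close> of \<open>Q\<close>, then
    \<open>A \<inter> B\<close> contains \<open>x\<close>, hence also \<open>y\<close>.\<close>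
  have "x \<in> \<Union>P" "x \<in> \<Union>Q" "y \<in> \<Union>P" "y \<in> \<Union>Q"
    using assms by (auto simp: finite_partition_def)
  moreover have "(x \<in> A \<inter> B) = (y \<in> A \<inter> B)"
    if "cell (partition_join P Q) x = cell (partition_join P Q) y" "A \<in> P" "B \<in> Q" for A B
    using that by (auto simp: cell_eq_iff partition_join_def)
  ultimately have "cell P x = cell P y \<and> cell Q x = cell Q y"
    if "cell (partition_join P Q) x = cell (partition_join P Q) y"
    using that unfolding cell_eq_iff by blast
  moreover have "cell (partition_join P Q) x = cell (partition_join P Q) y"
    if "cell P x = cell P y" "cell Q x = cell Q y"
    using that unfolding cell_eq_iff partition_join_def by blast
  ultimately show ?thesis by blast
qed

lemma finite_partition_vimage:
  assumes f: "f \<in> measurable M N" and P: "finite_partition N P"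
  shows "finite_partition M ((\<lambda>A. f -` A \<inter> space M) ` P)" (is "finite_partition M ?Q")
proof -
  have "disjoint ?Q"
    using P by (fastforce simp: finite_partition_def pairwise_def disjnt_def)
  moreover have "\<Union> ?Q = f -` (\<Union>P) \<inter> space M"
    by auto
  moreover have "\<dots> = space M"
    using P measurable_space[OF f] by (auto simp: finite_partition_def)
  moreover have "finite ?Q" "?Q \<subseteq> sets M"
    using P f by (auto simp: finite_partition_def intro!: measurable_sets)
  ultimately show ?thesis
    by (simp add: finite_partition_def)
qed

lemma cell_vimage:
  assumes "x \<in> space M" "y \<in> space M"
  shows "cell ((\<lambda>A. f -` A \<inter> space M) ` P) x = cell ((\<lambda>A. f -` A \<inter> space M) ` P) y \<longleftrightarrow>
    cell P (f x) = cell P (f y)"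
  using assms by (simp add: cell_eq_iff)

lemma partition_vimage_eq: "partition_vimage M T P = (\<lambda>A. T -` A \<inter> space M) ` P"
  by (auto simp: partition_vimage_def)

lemma simple_function_comp_measurable:
  assumes g: "g \<in> measurable M N" and f: "simple_function N f"
  shows "simple_function M (\<lambda>x. f (g x))"
  unfolding simple_function_def
proof (intro conjI ballI)
  show "finite ((\<lambda>x. f (g x)) ` space M)"
    by (rule finite_subset[OF _ simple_functionD(1)[OF f]]) (use measurable_space[OF g] in auto)
  fix v
  have "(\<lambda>x. f (g x)) -` {v} \<inter> space M = g -` (f -` {v} \<inter> space N) \<inter> space M"
    using measurable_space[OF g] by auto
  also have "\<dots> \<in> sets M"
    using simple_functionD(2)[OF f] by (rule measurable_sets[OF g])
  finally show "(\<lambda>x. f (g x)) -` {v} \<inter> space M \<in> sets M" .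
qed

text \<open>The common refinement of \<open>f\<close> at times \<open>0\<close> to
  \<open>n - 1\<close> as one function. With lists the type does not depend on \<open>n\<close>, and
  cutting a word in two gives subadditivity.\<close>

definition orbit_word :: "('a \<Rightarrow> 'a) \<Rightarrow> ('a \<Rightarrow> 'b) \<Rightarrow> nat \<Rightarrow> 'a \<Rightarrow> 'b list" where
  "orbit_word T f n x = map (\<lambda>i. f ((T ^^ i) x)) [0..<n]"

lemma orbit_word_0: "orbit_word T f 0 x = []"
  by (simp add: orbit_word_def)

lemma orbit_word_Suc: "orbit_word T f (Suc n) x = orbit_word T f n x @ [f ((T ^^ n) x)]"
  by (simp add: orbit_word_def)

lemma orbit_word_add: "orbit_word T f (m + n) x = orbit_word T f m x @ orbit_word T f n ((T ^^ m) x)"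
proof (induction n)
  case (Suc n)
  have "(T ^^ (m + n)) x = (T ^^ n) ((T ^^ m) x)"
    using funpow_add[of n m T] by (simp add: add.commute)
  then show ?case
    by (simp add: Suc orbit_word_Suc)
qed (simp add: orbit_word_0)

lemma orbit_word_eq_iff:
  "orbit_word T f n x = orbit_word T f n y \<longleftrightarrow> (\<forall>i<n. f ((T ^^ i) x) = f ((T ^^ i) y))"
  by (auto simp: orbit_word_def)

context information_space
begin

lemma entropy_nonneg:
  assumes "simple_function M X"
  shows "0 \<le> \<H>(X)"
proof -
  have "\<H>(\<lambda>_. ()) = 0"
    by (subst entropy_simple_function) (auto simp: prob_space not_empty vimage_def)
  then show ?thesis
    using entropy_mono[OF assms, of "\<lambda>_. ()"] by simp
qed

end

section \<open>Entropy rates of measure-preserving maps\<close>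

locale measure_preserving_system = information_space +
  fixes T :: "'a \<Rightarrow> 'a"
  assumes measure_preserving: "measure_preserving_map M T"
begin

lemma measurable_T: "T \<in> measurable M M" and distr_T: "distr M M T = M"
  using measure_preserving by (simp_all add: measure_preserving_map_def)

lemma measurable_funpow: "T ^^ n \<in> measurable M M"
  using measurable_T by (rule measurable_compose_n)

lemma distr_funpow: "distr M M (T ^^ n) = M"
proof (induction n)
  case 0
  show ?case by (simp add: distr_id[unfolded id_def])
next
  case (Suc n)
  have "distr M M (T ^^ Suc n) = distr (distr M M (T ^^ n)) M T"
    by (subst distr_distr) (simp_all add: measurable_T measurable_funpow)
  then show ?case by (simp only: Suc distr_T)
qed

lemma prob_funpow:
  assumes "A \<in> events"
  shows "prob ((T ^^ n) -` A \<inter> space M) = prob A"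
  using measure_distr[OF measurable_funpow[of n] assms] by (simp add: distr_funpow)

lemma funpow_space: "x \<in> space M \<Longrightarrow> (T ^^ n) x \<in> space M"
  using measurable_funpow by (rule measurable_space)

lemma vimage_funpow:
  "(\<lambda>x. f ((T ^^ n) x)) -` {v} \<inter> space M = (T ^^ n) -` (f -` {v} \<inter> space M) \<inter> space M"
  using funpow_space by auto

lemma simple_function_funpow:
  "simple_function M f \<Longrightarrow> simple_function M (\<lambda>x. f ((T ^^ n) x))"
  by (rule simple_function_comp_measurable[OF measurable_funpow])

lemma entropy_funpow:
  assumes f: "simple_function M f"
  shows "\<H>(\<lambda>x. f ((T ^^ n) x)) = \<H>(f)"
proof -
  have p: "prob ((\<lambda>x. f ((T ^^ n) x)) -` {v} \<inter> space M) = prob (f -` {v} \<inter> space M)" for v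
    unfolding vimage_funpow using simple_functionD(2)[OF f] by (rule prob_funpow)
  \<comment> \<open>\<open>T ^^ n\<close> need not be onto, so the composition may miss values of
    \<open>f\<close>; those have probability zero.\<close>
  have zero: "prob (f -` {v} \<inter> space M) = 0" if "v \<notin> (\<lambda>x. f ((T ^^ n) x)) ` space M" for v
    unfolding p[symmetric] using that by (intro arg_cong[where f=prob, of _ "{}", simplified]) auto
  show ?thesis
    unfolding entropy_simple_function[OF f] entropy_simple_function[OF simple_function_funpow[OF f]] p
    by (intro arg_cong[where f=uminus] sum.mono_neutral_left)
      (use funpow_space zero simple_functionD(1)[OF f] in auto)
qed

lemma simple_function_orbit_word:
  assumes f: "simple_function M f"
  shows "simple_function M (orbit_word T f n)"
proof (induction n)
  case (Suc n)
  from simple_function_compose2[OF Suc simple_function_funpow[OF f], of "\<lambda>w v. w @ [v]"]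
  show ?case by (simp add: orbit_word_Suc[abs_def])
qed (simp add: orbit_word_0[abs_def])

text \<open>The word is cut at time \<open>m\<close>; its second part is a shifted word, whose
  entropy is unchanged by invariance.\<close>

lemma entropy_orbit_word_subadditive:
  assumes f: "simple_function M f"
  shows "\<H>(orbit_word T f (m + n)) \<le> \<H>(orbit_word T f m) + \<H>(orbit_word T f n)"
proof -
  note sf = simple_function_orbit_word[OF f] simple_function_funpow[OF simple_function_orbit_word[OF f]]
  have "\<H>(orbit_word T f (m + n)) \<le> \<H>(\<lambda>x. (orbit_word T f m x, orbit_word T f n ((T ^^ m) x)))"
    by (rule entropy_mono) (auto simp: orbit_word_add intro!: simple_function_Pair sf)
  also have "\<dots> \<le> \<H>(orbit_word T f m) + \<H>(\<lambda>x. orbit_word T f n ((T ^^ m) x))"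
    by (intro entropy_subadditive sf)
  finally show ?thesis
    by (simp add: entropy_funpow simple_function_orbit_word f)
qed

text \<open>For simple \<open>f\<close>, the entropy of \<open>T\<close> relative to the partition
  into fibres of \<open>f\<close>, in base \<open>b\<close>; a factor \<open>ln b\<close> later
  restores natural logarithms.\<close>

definition entropy_rate :: "('a \<Rightarrow> 'b) \<Rightarrow> real" where
  "entropy_rate f = lim (\<lambda>n. \<H>(orbit_word T f n) / real n)"

lemma entropy_rate_LIMSEQ:
  assumes f: "simple_function M f"
  shows "(\<lambda>n. \<H>(orbit_word T f n) / real n) \<longlonglongrightarrow> entropy_rate f"
  unfolding entropy_rate_def convergent_LIMSEQ_iff[symmetric]
  by (intro fekete_subadditive entropy_nonneg simple_function_orbit_word
      entropy_orbit_word_subadditive f)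

text \<open>Once the \<open>r\<close>-word is known, each further letter of the
  \<open>g\<close>-word costs at most the entropy of \<open>g\<close> given \<open>r\<close>, by
  strong subadditivity and invariance.\<close>

lemma entropy_orbit_word_pair:
  assumes g: "simple_function M g" and r: "simple_function M r"
  shows "\<H>(\<lambda>x. (orbit_word T g n x, orbit_word T r n x)) \<le>
    \<H>(orbit_word T r n) + real n * cond_entropy g r"
proof (induction n)
  case 0
  have "\<H>(\<lambda>x. (orbit_word T g 0 x, orbit_word T r 0 x)) \<le> \<H>(orbit_word T r 0)"
    by (rule entropy_mono) (use simple_function_orbit_word[OF r] in \<open>auto simp: orbit_word_0\<close>)
  then show ?case by simp
next
  case (Suc n)
  let ?A = "orbit_word T g n" and ?C = "orbit_word T r n"
  let ?a = "\<lambda>x. g ((T ^^ n) x)" and ?c = "\<lambda>x. r ((T ^^ n) x)"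
  note sf = simple_function_orbit_word[OF g] simple_function_orbit_word[OF r]
    simple_function_funpow[OF g] simple_function_funpow[OF r]
  note sfp = sf simple_function_Pair
  have "\<H>(\<lambda>x. (orbit_word T g (Suc n) x, orbit_word T r (Suc n) x))
      \<le> \<H>(\<lambda>x. (?a x, (?A x, ?C x), ?c x))"
    by (rule entropy_mono) (auto simp: orbit_word_Suc intro!: sfp)
  \<comment> \<open>The new \<open>g\<close>-letter is no more uncertain given the past and
    \<open>?c\<close> than given \<open>?c\<close> alone.\<close>
  moreover have "\<H>(\<lambda>x. (?a x, (?A x, ?C x), ?c x)) + \<H>(?c)
      \<le> \<H>(\<lambda>x. (?a x, ?c x)) + \<H>(\<lambda>x. ((?A x, ?C x), ?c x))"
    by (intro entropy_strong_subadditive sfp)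
  moreover have "\<H>(\<lambda>x. ((?A x, ?C x), ?c x)) \<le> \<H>(\<lambda>x. (?A x, ?c x, ?C x))"
    by (rule entropy_mono) (auto intro!: sfp)
  \<comment> \<open>The new \<open>r\<close>-letter is no more uncertain given both past words than
    given the \<open>r\<close>-word alone.\<close>
  moreover have "\<H>(\<lambda>x. (?A x, ?c x, ?C x)) + \<H>(?C) \<le> \<H>(\<lambda>x. (?A x, ?C x)) + \<H>(\<lambda>x. (?c x, ?C x))"
    by (intro entropy_strong_subadditive sfp)
  moreover have "\<H>(\<lambda>x. (?c x, ?C x)) \<le> \<H>(orbit_word T r (Suc n))"
    by (rule entropy_mono) (auto simp: orbit_word_Suc intro!: simple_function_orbit_word r)
  moreover have "\<H>(\<lambda>x. (?a x, ?c x)) = \<H>(\<lambda>x. (g x, r x))" "\<H>(?c) = \<H>(r)"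
    using entropy_funpow[OF simple_function_Pair[OF g r]] entropy_funpow[OF r] by auto
  ultimately show ?case
    using Suc.IH by (simp add: algebra_simps)
qed

text \<open>The preceding bound divided by \<open>n\<close>; the cost per letter survives in the
  limit.\<close>

lemma entropy_rate_le:
  assumes g: "simple_function M g" and r: "simple_function M r"
  shows "entropy_rate g \<le> entropy_rate r + cond_entropy g r"
proof (rule LIMSEQ_le)
  let ?d = "cond_entropy g r"
  show "(\<lambda>n. \<H>(orbit_word T g n) / real n) \<longlonglongrightarrow> entropy_rate g"
    by (rule entropy_rate_LIMSEQ[OF g])
  show "(\<lambda>n. \<H>(orbit_word T r n) / real n + ?d) \<longlonglongrightarrow> entropy_rate r + ?d"
    by (intro tendsto_intros entropy_rate_LIMSEQ r)
  have "\<H>(orbit_word T g n) / real n \<le> \<H>(orbit_word T r n) / real n + ?d" if "n \<ge> 1" for n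
  proof -
    have "\<H>(orbit_word T g n) \<le> \<H>(\<lambda>x. (orbit_word T g n x, orbit_word T r n x))"
      by (rule entropy_mono) (auto intro!: simple_function_Pair simple_function_orbit_word g r)
    also note entropy_orbit_word_pair[OF g r]
    finally show ?thesis using that by (simp add: field_simps)
  qed
  then show "\<exists>N. \<forall>n\<ge>N. \<H>(orbit_word T g n) / real n \<le> \<H>(orbit_word T r n) / real n + ?d"
    by blast
qed

text \<open>Overlapping blocks of length \<open>m\<close> started at times below \<open>n\<close>
  read only letters at times below \<open>n + m\<close>. The \<open>m\<close> extra letters vanish
  in the average.\<close>

lemma entropy_rate_orbit_word:
  assumes f: "simple_function M f"
  shows "entropy_rate (orbit_word T f m) \<le> entropy_rate f"
proof (rule LIMSEQ_le)
  let ?w = "orbit_word T f"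
  show "(\<lambda>n. \<H>(orbit_word T (?w m) n) / real n) \<longlonglongrightarrow> entropy_rate (?w m)"
    by (intro entropy_rate_LIMSEQ simple_function_orbit_word f)
  have "(\<lambda>n. \<H>(?w n) / real n + \<H>(?w m) / real n) \<longlonglongrightarrow> entropy_rate f + 0"
    by (intro tendsto_add entropy_rate_LIMSEQ f lim_const_over_n)
  then show "(\<lambda>n. \<H>(?w n) / real n + \<H>(?w m) / real n) \<longlonglongrightarrow> entropy_rate f" by simp
  have "\<H>(orbit_word T (?w m) n) / real n \<le> \<H>(?w n) / real n + \<H>(?w m) / real n" for n
  proof -
    have "\<H>(orbit_word T (?w m) n) \<le> \<H>(?w (n + m))"
    proof (rule entropy_mono)
      fix x y assume "?w (n + m) x = ?w (n + m) y"
      then have *: "f ((T ^^ i) x) = f ((T ^^ i) y)" if "i < n + m" for i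
        using that by (simp add: orbit_word_eq_iff)
      have "?w m ((T ^^ i) x) = ?w m ((T ^^ i) y)" if "i < n" for i
        unfolding orbit_word_eq_iff
      proof (intro allI impI)
        fix j assume "j < m"
        then show "f ((T ^^ j) ((T ^^ i) x)) = f ((T ^^ j) ((T ^^ i) y))"
          using *[of "j + i"] that by (simp add: funpow_add)
      qed
      then show "orbit_word T (?w m) n x = orbit_word T (?w m) n y"
        by (simp add: orbit_word_eq_iff[of T "?w m"])
    qed (intro simple_function_orbit_word f)
    also have "\<dots> \<le> \<H>(?w n) + \<H>(?w m)"
      by (rule entropy_orbit_word_subadditive[OF f])
    finally show ?thesis
      by (simp add: divide_right_mono flip: add_divide_distrib)
  qed
  then show "\<exists>N. \<forall>n\<ge>N. \<H>(orbit_word T (?w m) n) / real n \<le> \<H>(?w n) / real n + \<H>(?w m) / real n"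
    by blast
qed

end

section \<open>Conditional entropy and its continuity\<close>

context information_space
begin

lemma shannon_entropy_eq:
  assumes P: "finite_partition M P" and f: "simple_function M f"
    and kernel: "\<And>x y. x \<in> space M \<Longrightarrow> y \<in> space M \<Longrightarrow> f x = f y \<longleftrightarrow> cell P x = cell P y"
  shows "shannon_entropy M P = ln b * \<H>(f)"
proof -
  have fiber: "f -` {f x} \<inter> space M = A" if "x \<in> A" "A \<in> P" for x A
  proof -
    have A: "A \<subseteq> space M" using P that by (auto simp: finite_partition_def)
    have disj: "y \<notin> B" if "y \<in> A" "B \<in> P" "B \<noteq> A" for y B
      using P that \<open>A \<in> P\<close> unfolding finite_partition_def disjoint_def by blast
    have "cell P y = cell P x \<longleftrightarrow> y \<in> A" for y
      unfolding cell_eq_iff using disj that by metis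
    then show ?thesis
      using kernel A that by (auto simp: subset_eq)
  qed
  \<comment> \<open>The fibres of \<open>f\<close> are exactly the nonempty cells; an empty cell
    adds \<open>0 * ln 0 = 0\<close> to the sum.\<close>
  have "bij_betw (\<lambda>v. f -` {v} \<inter> space M) (f ` space M) (P - {{}})"
    unfolding bij_betw_def
  proof
    show "inj_on (\<lambda>v. f -` {v} \<inter> space M) (f ` space M)"
      by (rule inj_onI) auto
    have "\<exists>A\<in>P. x \<in> A" if "x \<in> space M" for x
      using P that by (auto simp: finite_partition_def)
    moreover have "x \<in> space M" if "x \<in> A" "A \<in> P" for x A
      using P that by (auto simp: finite_partition_def)
    ultimately show "(\<lambda>v. f -` {v} \<inter> space M) ` f ` space M = P - {{}}"
      using fiber by (fastforce simp: image_iff)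
  qed
  then have "(\<Sum>v\<in>f ` space M. prob (f -` {v} \<inter> space M) * ln (prob (f -` {v} \<inter> space M))) =
      (\<Sum>A\<in>P - {{}}. prob A * ln (prob A))"
    by (rule sum.reindex_bij_betw)
  also have "\<dots> = (\<Sum>A\<in>P. prob A * ln (prob A))"
    using P by (intro sum.mono_neutral_left) (auto simp: finite_partition_def)
  finally have "shannon_entropy M P =
      - (\<Sum>v\<in>f ` space M. prob (f -` {v} \<inter> space M) * ln (prob (f -` {v} \<inter> space M)))"
    by (simp only: shannon_entropy_def)
  moreover have "p * ln p = ln b * (p * log b p)" for p :: real
    using b_gt_1 by (simp add: log_def)
  ultimately show ?thesis
    by (simp only: entropy_simple_function[OF f] sum_distrib_left mult_minus_right)
qed

text \<open>Strong subadditivity over \<open>R\<close>; since \<open>R'\<close> determines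
  \<open>R\<close>, adjoining \<open>R\<close> to \<open>R'\<close> adds no entropy.\<close>

lemma cond_entropy_antimono:
  assumes X: "simple_function M X" and R: "simple_function M R" and R': "simple_function M R'"
    and det: "\<And>x y. x \<in> space M \<Longrightarrow> y \<in> space M \<Longrightarrow> R' x = R' y \<Longrightarrow> R x = R y"
  shows "cond_entropy X R' \<le> cond_entropy X R"
proof -
  have "\<H>(\<lambda>x. (X x, R' x, R x)) + \<H>(R) \<le> \<H>(\<lambda>x. (X x, R x)) + \<H>(\<lambda>x. (R' x, R x))"
    by (rule entropy_strong_subadditive[OF X R' R])
  moreover have "\<H>(\<lambda>x. (R' x, R x)) \<le> \<H>(R')"
    by (rule entropy_mono[OF R']) (metis det Pair_inject)
  moreover have "\<H>(\<lambda>x. (X x, R' x)) \<le> \<H>(\<lambda>x. (X x, R' x, R x))"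
    by (rule entropy_mono[OF simple_function_Pair[OF X simple_function_Pair[OF R' R]]]) auto
  ultimately show ?thesis by simp
qed

lemma cond_entropy_determined:
  assumes R: "simple_function M R"
    and det: "\<And>x y. x \<in> space M \<Longrightarrow> y \<in> space M \<Longrightarrow> R x = R y \<Longrightarrow> X x = X y"
  shows "cond_entropy X R \<le> 0"
proof -
  have "\<H>(\<lambda>x. (X x, R x)) \<le> \<H>(R)"
    by (rule entropy_mono[OF R]) (metis det Pair_inject)
  then show ?thesis by simp
qed

lemma cond_entropy_mono:
  assumes X: "simple_function M X" and R: "simple_function M R"
    and det: "\<And>x y. x \<in> space M \<Longrightarrow> y \<in> space M \<Longrightarrow> X x = X y \<Longrightarrow> Y x = Y y"
  shows "cond_entropy Y R \<le> cond_entropy X R"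
proof -
  have "\<H>(\<lambda>x. (Y x, R x)) \<le> \<H>(\<lambda>x. (X x, R x))"
    by (rule entropy_mono[OF simple_function_Pair[OF X R]]) (metis det Pair_inject)
  then show ?thesis by simp
qed

lemma cond_entropy_pair:
  assumes X: "simple_function M X" and Y: "simple_function M Y" and R: "simple_function M R"
  shows "cond_entropy (\<lambda>x. (X x, Y x)) R \<le> cond_entropy X R + cond_entropy Y R"
proof -
  have "\<H>(\<lambda>x. ((X x, Y x), R x)) \<le> \<H>(\<lambda>x. (X x, Y x, R x))"
    by (rule entropy_mono[OF simple_function_Pair[OF X simple_function_Pair[OF Y R]]]) auto
  then show ?thesis
    using entropy_strong_subadditive[OF X Y R] by simp
qed

text \<open>Adjoining \<open>Y\<close> to \<open>(X, R)\<close> can only raise the entropy, and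
  conditioning \<open>X\<close> on \<open>R\<close> besides \<open>Y\<close> can only lower the
  conditional one.\<close>

lemma cond_entropy_triangle:
  assumes X: "simple_function M X" and Y: "simple_function M Y" and R: "simple_function M R"
  shows "cond_entropy X R \<le> cond_entropy X Y + cond_entropy Y R"
proof -
  have "\<H>(\<lambda>x. (X x, R x)) \<le> \<H>(\<lambda>x. (X x, R x, Y x))"
    by (rule entropy_mono[OF simple_function_Pair[OF X simple_function_Pair[OF R Y]]]) auto
  moreover have "\<H>(\<lambda>x. (R x, Y x)) \<le> \<H>(\<lambda>x. (Y x, R x))"
    by (rule entropy_mono[OF simple_function_Pair[OF Y R]]) auto
  ultimately show ?thesis
    using entropy_strong_subadditive[OF X R Y] by simp
qed

lemma entropy_superset:
  assumes X: "simple_function M X" and S: "finite S" "X ` space M \<subseteq> S"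
  shows "\<H>(X) = - (\<Sum>v\<in>S. prob (X -` {v} \<inter> space M) * log b (prob (X -` {v} \<inter> space M)))"
proof -
  have "X -` {v} \<inter> space M = {}" if "v \<notin> X ` space M" for v
    using that by auto
  then show ?thesis
    unfolding entropy_simple_function[OF X] using S
    by (intro arg_cong[where f=uminus] sum.mono_neutral_left) auto
qed

lemma simple_function_mem:
  assumes "B \<in> events" shows "simple_function M (\<lambda>x. x \<in> B)"
  unfolding simple_function_def
proof (intro conjI ballI)
  fix v
  have "(\<lambda>x. x \<in> B) -` {v} \<inter> space M = (if v then B \<inter> space M else space M - B)"
    by auto
  then show "(\<lambda>x. x \<in> B) -` {v} \<inter> space M \<in> events"
    using assms by simp
qed simp

text \<open>Inclusion leaves only three joint atoms, \<open>C\<close>, \<open>B - C\<close> and the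
  complement of \<open>B\<close>; the \<open>prob C\<close> terms cancel. The explicit form is what
  allows a passage to the limit.\<close>

lemma cond_entropy_nested:
  assumes B: "B \<in> events" and C: "C \<in> events" and "C \<subseteq> B"
  shows "cond_entropy (\<lambda>x. x \<in> B) (\<lambda>x. x \<in> C) =
    (1 - prob C) * log b (1 - prob C) - (prob B - prob C) * log b (prob B - prob C)
    - (1 - prob B) * log b (1 - prob B)"
proof -
  let ?W = "\<lambda>x. (x \<in> B, x \<in> C)"
  note sf = simple_function_mem[OF B] simple_function_mem[OF C]
  have "?W -` {(True, True)} \<inter> space M = C" "?W -` {(True, False)} \<inter> space M = B - C"
    "?W -` {(False, False)} \<inter> space M = space M - B"
    using assms sets.sets_into_space by auto
  moreover have "\<H>(?W) = - (\<Sum>v\<in>{(True, True), (True, False), (False, False)}.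
      prob (?W -` {v} \<inter> space M) * log b (prob (?W -` {v} \<inter> space M)))"
    by (rule entropy_superset) (use \<open>C \<subseteq> B\<close> simple_function_Pair[OF sf] in auto)
  ultimately have W: "\<H>(?W) = - (prob C * log b (prob C) + (prob B - prob C) * log b (prob B - prob C)
      + (1 - prob B) * log b (1 - prob B))"
    using assms by (simp add: prob_compl finite_measure_Diff)
  have "(\<lambda>x. x \<in> C) -` {True} \<inter> space M = C" "(\<lambda>x. x \<in> C) -` {False} \<inter> space M = space M - C"
    using C sets.sets_into_space by auto
  moreover have "\<H>(\<lambda>x. x \<in> C) = - (\<Sum>v\<in>{True, False}.
      prob ((\<lambda>x. x \<in> C) -` {v} \<inter> space M) * log b (prob ((\<lambda>x. x \<in> C) -` {v} \<inter> space M)))"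
    by (rule entropy_superset[OF sf(2)]) auto
  ultimately have "\<H>(\<lambda>x. x \<in> C) = - (prob C * log b (prob C) + (1 - prob C) * log b (1 - prob C))"
    using C by (simp add: prob_compl)
  with W show ?thesis by simp
qed

text \<open>The endpoint \<open>0\<close> matters, since \<open>prob B - prob C\<close> will tend to
  it. The value there is \<open>0\<close>, which is also the right-hand limit.\<close>

lemma continuous_on_mult_log: "continuous_on {0..} (\<lambda>t. t * log b t)"
  unfolding continuous_on_eq_continuous_within
proof
  fix t :: real assume "t \<in> {0..}"
  show "continuous (at t within {0..}) (\<lambda>t. t * log b t)"
  proof (cases "t = 0")
    case True
    have "((\<lambda>t::real. t * ln t / ln b) \<longlongrightarrow> 0 / ln b) (at_right 0)"
      by (intro tendsto_divide tendsto_const) (real_asymp, use b_gt_1 in simp)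
    then show ?thesis
      unfolding True continuous_within at_within_Ici_at_right by (simp add: log_def)
  next
    case False
    then have "isCont (\<lambda>t. t * log b t) t"
      using \<open>t \<in> {0..}\<close> b_gt_1 by (auto intro!: continuous_intros)
    then show ?thesis by (rule continuous_at_imp_continuous_at_within)
  qed
qed

text \<open>By continuity from below the finite unions exhaust the measure of the whole union. In
  the nested formula the outer terms then cancel and the middle one tends to
  \<open>0\<close>.\<close>

lemma cond_entropy_UN_tendsto:
  assumes A: "\<And>i::nat. A i \<in> events"
  shows "(\<lambda>n. cond_entropy (\<lambda>x. x \<in> (\<Union>i. A i)) (\<lambda>x. x \<in> (\<Union>i<n. A i))) \<longlonglongrightarrow> 0"
proof -
  let ?C = "\<lambda>n. \<Union>i<n. A i" and ?B = "\<Union>i. A i"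
  let ?h = "\<lambda>t. t * log b t"
  have C: "?C n \<in> events" for n using A by auto
  have B: "?B \<in> events" using A by auto
  have sub: "?C n \<subseteq> ?B" for n by auto
  have "(\<lambda>n. prob (?C n)) \<longlonglongrightarrow> prob (\<Union>n. ?C n)"
  proof (rule finite_Lim_measure_incseq)
    show "range ?C \<subseteq> events" using C by blast
    show "incseq ?C" unfolding incseq_def by (intro allI impI UN_mono) auto
  qed
  moreover have "(\<Union>n. ?C n) = ?B" by auto
  ultimately have lim: "(\<lambda>n. prob (?C n)) \<longlonglongrightarrow> prob ?B" by metis
  have "(\<lambda>n. ?h (1 - prob (?C n))) \<longlonglongrightarrow> ?h (1 - prob ?B)"
    by (rule continuous_on_tendsto_compose[OF continuous_on_mult_log])
      (auto intro!: tendsto_intros lim)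
  moreover have "(\<lambda>n. ?h (prob ?B - prob (?C n))) \<longlonglongrightarrow> ?h (prob ?B - prob ?B)"
  proof (rule continuous_on_tendsto_compose[OF continuous_on_mult_log])
    show "(\<lambda>n. prob ?B - prob (?C n)) \<longlonglongrightarrow> prob ?B - prob ?B"
      by (intro tendsto_diff tendsto_const lim)
    show "\<forall>\<^sub>F n in sequentially. prob ?B - prob (?C n) \<in> {0..}"
      using finite_measure_mono[OF sub B] by (intro always_eventually) simp
  qed simp
  ultimately have "(\<lambda>n. ?h (1 - prob (?C n)) - ?h (prob ?B - prob (?C n)) - ?h (1 - prob ?B))
      \<longlonglongrightarrow> ?h (1 - prob ?B) - ?h (prob ?B - prob ?B) - ?h (1 - prob ?B)"
    by (intro tendsto_diff tendsto_const)
  then show ?thesis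
    unfolding cond_entropy_nested[OF B C sub] by simp
qed

end

section \<open>Entropy of iterated joins\<close>

context measure_preserving_system
begin

lemma finite_partition_iterated_join:
  assumes "finite_partition M P"
  shows "finite_partition M (iterated_join M T P n)"
proof (induction n)
  case 0
  then show ?case by (simp add: finite_partition_def)
next
  case (Suc n)
  then show ?case
    using finite_partition_vimage[OF measurable_funpow assms]
    by (simp add: finite_partition_join partition_vimage_eq)
qed

lemma cell_iterated_join:
  assumes P: "finite_partition M P" and x: "x \<in> space M" and y: "y \<in> space M"
  shows "cell (iterated_join M T P n) x = cell (iterated_join M T P n) y \<longleftrightarrow>
    (\<forall>i<n. cell P ((T ^^ i) x) = cell P ((T ^^ i) y))"
proof (induction n)
  case 0
  then show ?case using x y by (simp add: cell_eq_iff)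
next
  case (Suc n)
  have "cell (iterated_join M T P (Suc n)) x = cell (iterated_join M T P (Suc n)) y \<longleftrightarrow>
      cell (iterated_join M T P n) x = cell (iterated_join M T P n) y \<and>
      cell P ((T ^^ n) x) = cell P ((T ^^ n) y)"
    unfolding iterated_join.simps partition_vimage_eq
    by (subst cell_partition_join[OF finite_partition_iterated_join[OF P]
          finite_partition_vimage[OF measurable_funpow P] x y]) (simp only: cell_vimage[OF x y])
  then show ?case
    unfolding Suc by (auto simp: less_Suc_eq)
qed

text \<open>The words of \<open>f\<close> have the nonempty cells of the iterated join as fibres.
  Convergence, rather than a value of \<open>lim\<close>, is stated because it also evaluates the
  limsup for cylinders.\<close>

lemma shannon_entropy_iterated_join_LIMSEQ:
  assumes P: "finite_partition M P" and f: "simple_function M f"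
    and kernel: "\<And>x y. x \<in> space M \<Longrightarrow> y \<in> space M \<Longrightarrow> f x = f y \<longleftrightarrow> cell P x = cell P y"
  shows "(\<lambda>n. ereal (1 / real n * shannon_entropy M (iterated_join M T P n)))
    \<longlonglongrightarrow> ereal (ln b * entropy_rate f)"
proof -
  have "shannon_entropy M (iterated_join M T P n) = ln b * \<H>(orbit_word T f n)" for n
  proof (rule shannon_entropy_eq[OF finite_partition_iterated_join[OF P] simple_function_orbit_word[OF f]])
    fix x y assume "x \<in> space M" "y \<in> space M"
    then show "orbit_word T f n x = orbit_word T f n y \<longleftrightarrow>
        cell (iterated_join M T P n) x = cell (iterated_join M T P n) y"
      by (simp add: orbit_word_eq_iff cell_iterated_join[OF P] kernel funpow_space)
  qed
  moreover have "(\<lambda>n. ln b * (\<H>(orbit_word T f n) / real n)) \<longlonglongrightarrow> ln b * entropy_rate f"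
    by (intro tendsto_mult tendsto_const entropy_rate_LIMSEQ f)
  ultimately show ?thesis by simp
qed

lemma sh_entropy_wrt_eq:
  assumes "finite_partition M P" and "simple_function M f"
    and "\<And>x y. x \<in> space M \<Longrightarrow> y \<in> space M \<Longrightarrow> f x = f y \<longleftrightarrow> cell P x = cell P y"
  shows "sh_entropy_wrt T M P = ereal (ln b * entropy_rate f)"
  unfolding sh_entropy_wrt_def
  by (rule limI[OF shannon_entropy_iterated_join_LIMSEQ[OF assms]])

end

section \<open>Stationary processes\<close>

text \<open>Here \<open>M\<close> is the measure on sequences and \<open>N\<close> the state space,
  which the definitions of the infinite-product entropy call \<open>M\<close>.\<close>

locale stationary_process = measure_preserving_system M b seq_shift
  for M :: "(nat \<Rightarrow> 'a) measure" and b +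
  fixes N :: "'a measure"
  assumes sets_eq: "sets M = sets (\<Pi>\<^sub>M n\<in>UNIV. N)"
begin

lemma space_eq: "space M = (\<Pi>\<^sub>E n\<in>UNIV. space N)"
  using sets_eq_imp_space_eq[OF sets_eq] by (simp add: space_PiM)

lemma measurable_coordinate: "(\<lambda>x. x n) \<in> measurable M N"
  unfolding measurable_cong_sets[OF sets_eq refl] by (rule measurable_component_singleton) simp

lemma funpow_seq_shift: "(seq_shift ^^ i) x n = x (n + i)"
  by (induction i arbitrary: n) (simp_all add: seq_shift_def)

text \<open>The \<open>P\<close>-name of ergodic theory: for a partition \<open>P\<close>, it
  separates sequences exactly as the cylinder partition of length \<open>m\<close> does.\<close>

definition name :: "'a set set \<Rightarrow> nat \<Rightarrow> (nat \<Rightarrow> 'a) \<Rightarrow> 'a set set list" where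
  "name P = orbit_word seq_shift (\<lambda>x. cell P (x 0))"

lemma name_eq_iff: "name P m x = name P m y \<longleftrightarrow> (\<forall>i<m. cell P (x i) = cell P (y i))"
  by (simp add: name_def orbit_word_eq_iff funpow_seq_shift)

lemma simple_function_cell_coordinate:
  assumes "finite_partition N P"
  shows "simple_function M (\<lambda>x. cell P (x n))"
  using assms by (intro simple_function_comp_measurable[OF measurable_coordinate] simple_function_cell)
    (auto simp: finite_partition_def)

lemma simple_function_name:
  "finite_partition N P \<Longrightarrow> simple_function M (name P m)"
  unfolding name_def by (intro simple_function_orbit_word simple_function_cell_coordinate)

section \<open>Approximation by names\<close>

definition approximable :: "((nat \<Rightarrow> 'a) \<Rightarrow> 'b) \<Rightarrow> bool" where
  "approximable X \<longleftrightarrow> simple_function M X \<and>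
    (\<forall>e>0. \<exists>P m. finite_partition N P \<and> cond_entropy X (name P m) < e)"

lemma approximable_simple: "approximable X \<Longrightarrow> simple_function M X"
  by (simp add: approximable_def)

lemma approximable_determined_by_name:
  assumes X: "simple_function M X" and P: "finite_partition N P"
    and det: "\<And>x y. x \<in> space M \<Longrightarrow> y \<in> space M \<Longrightarrow> name P m x = name P m y \<Longrightarrow> X x = X y"
  shows "approximable X"
  unfolding approximable_def
proof (intro conjI allI impI exI)
  fix e :: real assume "0 < e"
  have "cond_entropy X (name P m) \<le> 0"
    by (rule cond_entropy_determined[OF simple_function_name[OF P] det])
  with \<open>0 < e\<close> show "cond_entropy X (name P m) < e" by linarith
qed (use X P in simp_all)

lemma approximable_determined:
  assumes X: "approximable X" and Y: "simple_function M Y"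
    and det: "\<And>x y. x \<in> space M \<Longrightarrow> y \<in> space M \<Longrightarrow> X x = X y \<Longrightarrow> Y x = Y y"
  shows "approximable Y"
  unfolding approximable_def
proof (intro conjI allI impI)
  fix e :: real assume "0 < e"
  then obtain P m where P: "finite_partition N P" and "cond_entropy X (name P m) < e"
    using X unfolding approximable_def by blast
  moreover have "cond_entropy Y (name P m) \<le> cond_entropy X (name P m)"
    by (rule cond_entropy_mono[OF approximable_simple[OF X] simple_function_name[OF P] det])
  ultimately have "cond_entropy Y (name P m) < e" by linarith
  with P show "\<exists>P m. finite_partition N P \<and> cond_entropy Y (name P m) < e" by blast
qed fact

text \<open>Two names are dominated by one, with the join of the partitions and the larger length;
  conditioning on it raises neither conditional entropy.\<close>

lemma approximable_pair:
  assumes X: "approximable X" and Y: "approximable Y"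
  shows "approximable (\<lambda>x. (X x, Y x))"
  unfolding approximable_def
proof (intro conjI allI impI)
  note sf = approximable_simple[OF X] approximable_simple[OF Y]
  show "simple_function M (\<lambda>x. (X x, Y x))" by (intro simple_function_Pair sf)
  fix e :: real assume "0 < e"
  then have "0 < e / 2" by simp
  then obtain P m Q n where P: "finite_partition N P" "cond_entropy X (name P m) < e / 2"
    and Q: "finite_partition N Q" "cond_entropy Y (name Q n) < e / 2"
    using X Y unfolding approximable_def by meson
  define R where "R = partition_join P Q"
  define k where "k = max m n"
  have R: "finite_partition N R"
    unfolding R_def by (rule finite_partition_join[OF P(1) Q(1)])
  have RPQ: "cell R u = cell R v \<longleftrightarrow> cell P u = cell P v \<and> cell Q u = cell Q v"
    if "u \<in> space N" "v \<in> space N" for u v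
    unfolding R_def by (rule cell_partition_join[OF P(1) Q(1) that])
  have coord: "x i \<in> space N" if "x \<in> space M" for x i
    using that by (auto simp: space_eq)
  have "cond_entropy X (name R k) \<le> cond_entropy X (name P m)"
    by (rule cond_entropy_antimono[OF sf(1) simple_function_name[OF P(1)] simple_function_name[OF R]])
      (auto simp: name_eq_iff RPQ coord k_def)
  moreover have "cond_entropy Y (name R k) \<le> cond_entropy Y (name Q n)"
    by (rule cond_entropy_antimono[OF sf(2) simple_function_name[OF Q(1)] simple_function_name[OF R]])
      (auto simp: name_eq_iff RPQ coord k_def)
  moreover have "cond_entropy (\<lambda>x. (X x, Y x)) (name R k)
      \<le> cond_entropy X (name R k) + cond_entropy Y (name R k)"
    by (rule cond_entropy_pair[OF sf simple_function_name[OF R]])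
  ultimately have "cond_entropy (\<lambda>x. (X x, Y x)) (name R k) < e"
    using P(2) Q(2) by linarith
  with R show "\<exists>P m. finite_partition N P \<and> cond_entropy (\<lambda>x. (X x, Y x)) (name P m) < e" by blast
qed

text \<open>Triangle inequality: half of \<open>e\<close> pays for replacing \<open>X\<close> by
  \<open>Y\<close>, half for approximating \<open>Y\<close> by a name.\<close>

lemma approximable_limit:
  assumes X: "simple_function M X"
    and "\<And>e. 0 < e \<Longrightarrow> \<exists>Y. approximable Y \<and> cond_entropy X (Y :: _ \<Rightarrow> 'c) < e"
  shows "approximable X"
  unfolding approximable_def
proof (intro conjI allI impI)
  fix e :: real assume "0 < e"
  then have "0 < e / 2" by simp
  then obtain Y :: "_ \<Rightarrow> 'c" where Y: "approximable Y" "cond_entropy X Y < e / 2"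
    using assms(2) by blast
  then obtain P m where P: "finite_partition N P" "cond_entropy Y (name P m) < e / 2"
    using \<open>0 < e / 2\<close> unfolding approximable_def by blast
  have "cond_entropy X (name P m) \<le> cond_entropy X Y + cond_entropy Y (name P m)"
    by (rule cond_entropy_triangle[OF X approximable_simple[OF Y(1)] simple_function_name[OF P(1)]])
  then have "cond_entropy X (name P m) < e" using Y(2) P(2) by linarith
  with P(1) show "\<exists>P m. finite_partition N P \<and> cond_entropy X (name P m) < e" by blast
qed fact

lemma approximable_coordinate:
  assumes A: "A \<in> sets N"
  shows "approximable (\<lambda>x. x \<in> {x \<in> space M. x i \<in> A})"
proof (rule approximable_determined_by_name)
  have "{x \<in> space M. x i \<in> A} = (\<lambda>x. x i) -` A \<inter> space M" by auto
  then show "simple_function M (\<lambda>x. x \<in> {x \<in> space M. x i \<in> A})"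
    using measurable_sets[OF measurable_coordinate A] by (intro simple_function_mem) simp
  \<comment> \<open>The coarsest partition that decides \<open>A\<close>; names of length
    \<open>Suc i\<close> are the first to read coordinate \<open>i\<close>.\<close>
  show "finite_partition N {A, space N - A}"
    using A sets.sets_into_space[OF A] by (auto simp: finite_partition_def disjoint_def)
  show "(x \<in> {x \<in> space M. x i \<in> A}) = (y \<in> {x \<in> space M. x i \<in> A})"
    if "x \<in> space M" "y \<in> space M" "name {A, space N - A} (Suc i) x = name {A, space N - A} (Suc i) y" for x y
    using that by (auto simp: name_eq_iff cell_eq_iff)
qed

text \<open>Induction over the generation of the product \<open>\<sigma>\<close>-algebra from
  single-coordinate events; a complement has the same fibres as its set.\<close>

lemma approximable_mem:
  assumes "B \<in> events"
  shows "approximable (\<lambda>x. x \<in> B)"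
proof -
  let ?G = "{{x \<in> space M. x i \<in> A} | i A. A \<in> sets N}"
  have events: "events = sigma_sets (space M) ?G"
    using sets_eq sets_PiM_single[of UNIV "\<lambda>_. N"] by (simp add: space_eq)
  from assms have "B \<in> sigma_sets (space M) ?G" by (simp only: events)
  then show ?thesis
  proof (induction rule: sigma_sets.induct)
    case (Basic B)
    then show ?case using approximable_coordinate by blast
  next
    case Empty
    \<comment> \<open>A constant indicator is determined by every name; the trivial partition
      supplies one.\<close>
    have "finite_partition N {space N}" by (simp add: finite_partition_def)
    then show ?case by (rule approximable_determined_by_name[rotated]) auto
  next
    case (Compl B)
    then have "B \<in> events" by (simp only: events)
    then show ?case
      by (intro approximable_determined[OF Compl.IH] simple_function_mem) auto
  next
    case (Union A)
    then have A: "A i \<in> events" for i by (simp only: events)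
    \<comment> \<open>Finite unions come from pairing; the countable union is then a limit of them
      in conditional entropy.\<close>
    have C: "approximable (\<lambda>x. x \<in> (\<Union>i<n. A i))" for n
    proof (induction n)
      case 0
      have "finite_partition N {space N}" by (simp add: finite_partition_def)
      then show ?case by (rule approximable_determined_by_name[rotated]) auto
    next
      case (Suc n)
      show ?case
      proof (rule approximable_determined[OF approximable_pair[OF Suc Union.IH[of n]]])
        show "simple_function M (\<lambda>x. x \<in> (\<Union>i<Suc n. A i))"
          using A by (intro simple_function_mem) auto
      qed (auto simp: lessThan_Suc)
    qed
    show ?case
    proof (rule approximable_limit)
      show "simple_function M (\<lambda>x. x \<in> (\<Union>i. A i))"
        using A by (intro simple_function_mem) auto
      fix e :: real assume "0 < e"
      then have "\<forall>\<^sub>F n in sequentially. cond_entropy (\<lambda>x. x \<in> (\<Union>i. A i)) (\<lambda>x. x \<in> (\<Union>i<n. A i)) < e"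
        using cond_entropy_UN_tendsto[OF A] by (rule order_tendstoD(2)[rotated])
      then obtain n where "cond_entropy (\<lambda>x. x \<in> (\<Union>i. A i)) (\<lambda>x. x \<in> (\<Union>i<n. A i)) < e"
        by (auto simp: eventually_sequentially)
      with C show "\<exists>Y. approximable Y \<and> cond_entropy (\<lambda>x. x \<in> (\<Union>i. A i)) (Y :: _ \<Rightarrow> bool) < e"
        by blast
    qed
  qed
qed

text \<open>\<open>cell F\<close> makes sense for families that are not partitions, so events can be
  added one at a time: membership in \<open>A\<close> together with \<open>cell F\<close> determines
  the cell of the enlarged family.\<close>

lemma approximable_cell:
  assumes "finite F" "F \<subseteq> events"
  shows "approximable (cell F)"
  using assms
proof (induction F)
  case empty
  have "finite_partition N {space N}" by (simp add: finite_partition_def)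
  then show ?case
    by (rule approximable_determined_by_name[rotated]) (auto simp: cell_def)
next
  case (insert A F)
  then have "approximable (\<lambda>x. (x \<in> A, cell F x))"
    by (intro approximable_pair approximable_mem) auto
  then show ?case
    by (rule approximable_determined) (use insert in \<open>auto simp: cell_eq_iff intro!: simple_function_cell\<close>)
qed

section \<open>Cylinder partitions and the comparison of the two entropies\<close>

lemma cylinder_partition_eq:
  assumes P: "P \<subseteq> Pow (space N)"
  shows "cylinder_partition N P n = iterated_join M seq_shift ((\<lambda>A. (\<lambda>x. x 0) -` A \<inter> space M) ` P) n"
proof (induction n)
  case 0
  then show ?case
    by (auto simp: cylinder_partition_def cylinder_def space_eq)
next
  case (Suc n)
  \<comment> \<open>The one new constraint in a cylinder of length \<open>Suc n\<close>. Coordinate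
    \<open>n\<close> is coordinate \<open>0\<close> after \<open>n\<close> shifts, so it is also the
    cell that the next join adds.\<close>
  let ?D = "\<lambda>A. {x \<in> space M. x n \<in> A}"
  have mem_cylinder: "x \<in> cylinder N k A \<longleftrightarrow> (\<forall>i<k. x i \<in> A i) \<and> (\<forall>i\<ge>k. x i \<in> space N)" for x k A
    by (auto simp: cylinder_def PiE_iff not_less)
  have step: "cylinder N (Suc n) A = cylinder N n A \<inter> ?D (A n)" if "\<forall>i<Suc n. A i \<in> P" for A
  proof (rule set_eqI)
    fix x
    have "A i \<subseteq> space N" if "i < Suc n" for i
      using that \<open>\<forall>i<Suc n. A i \<in> P\<close> P by blast
    then have "x i \<in> space N" if "x \<in> cylinder N (Suc n) A" for i
      using that by (cases "i < Suc n") (auto simp: mem_cylinder not_less)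
    moreover have "x \<in> cylinder N (Suc n) A \<longleftrightarrow> x \<in> cylinder N n A \<and> x n \<in> A n" if "x n \<in> space N"
    proof -
      have "(\<forall>i\<ge>n. x i \<in> space N) \<longleftrightarrow> (\<forall>i\<ge>Suc n. x i \<in> space N)"
        using that by (metis Suc_leD not_less_eq_eq le_antisym)
      then show ?thesis unfolding mem_cylinder All_less_Suc by blast
    qed
    ultimately show "x \<in> cylinder N (Suc n) A \<longleftrightarrow> x \<in> cylinder N n A \<inter> ?D (A n)"
      by (auto simp: space_eq PiE_iff)
  qed
  have "cylinder_partition N P (Suc n) = partition_join (cylinder_partition N P n) (?D ` P)"
  proof (intro equalityI subsetI)
    fix C assume "C \<in> cylinder_partition N P (Suc n)"
    then obtain A where A: "\<forall>i<Suc n. A i \<in> P" "C = cylinder N (Suc n) A"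
      by (auto simp: cylinder_partition_def)
    then have "C = cylinder N n A \<inter> ?D (A n)" by (simp only: step)
    moreover have "cylinder N n A \<in> cylinder_partition N P n" "?D (A n) \<in> ?D ` P"
      using A by (auto simp: cylinder_partition_def)
    ultimately show "C \<in> partition_join (cylinder_partition N P n) (?D ` P)"
      unfolding partition_join_def by blast
  next
    fix C assume "C \<in> partition_join (cylinder_partition N P n) (?D ` P)"
    then obtain A B where A: "\<forall>i<n. A i \<in> P" and B: "B \<in> P" and C: "C = cylinder N n A \<inter> ?D B"
      by (auto simp: partition_join_def cylinder_partition_def)
    \<comment> \<open>Overwriting entry \<open>n\<close> leaves the cylinder of length
      \<open>n\<close> unchanged.\<close>
    define A' where "A' = A(n := B)"
    have A': "\<forall>i<Suc n. A' i \<in> P"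
      using A B by (simp add: A'_def)
    have cyl: "cylinder N n A = cylinder N n A'" and "A' n = B"
      unfolding set_eq_iff mem_cylinder by (simp_all add: A'_def)
    then have "C = cylinder N (Suc n) A'"
      by (simp only: C step[OF A'])
    with A' show "C \<in> cylinder_partition N P (Suc n)"
      unfolding cylinder_partition_def by blast
  qed
  moreover have "partition_vimage M (seq_shift ^^ n) ((\<lambda>A. (\<lambda>x. x 0) -` A \<inter> space M) ` P) = ?D ` P"
    unfolding partition_vimage_eq image_image using funpow_space
    by (intro image_cong) (auto simp: funpow_seq_shift)
  ultimately show ?case
    by (simp only: Suc iterated_join.simps)
qed

text \<open>Cylinder partitions of \<open>P\<close> are the iterated joins of \<open>Q\<close>,
  whose normalised entropies converge; limsup and limit therefore agree.\<close>

lemma ip_entropy_wrt_eq: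
  assumes P: "finite_partition N P"
  defines "Q \<equiv> (\<lambda>A. (\<lambda>x. x 0) -` A \<inter> space M) ` P"
  shows "finite_partition M Q"
    and "ip_entropy_wrt N M P = sh_entropy_wrt seq_shift M Q"
    and "ip_entropy_wrt N M P = ereal (ln b * entropy_rate (\<lambda>x. cell P (x 0)))"
proof -
  show Q: "finite_partition M Q"
    unfolding Q_def by (rule finite_partition_vimage[OF measurable_coordinate P])
  have kernel: "cell P (x 0) = cell P (y 0) \<longleftrightarrow> cell Q x = cell Q y"
    if "x \<in> space M" "y \<in> space M" for x y
    unfolding Q_def using cell_vimage[OF that, of "\<lambda>x. x 0" P] by simp
  note f = simple_function_cell_coordinate[OF P, of 0]
  have P': "P \<subseteq> Pow (space N)" using P by (auto simp: finite_partition_def)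
  show rate: "ip_entropy_wrt N M P = ereal (ln b * entropy_rate (\<lambda>x. cell P (x 0)))"
    unfolding ip_entropy_wrt_def cylinder_partition_eq[OF P'] Q_def[symmetric]
    by (rule lim_imp_Limsup[OF trivial_limit_sequentially
          shannon_entropy_iterated_join_LIMSEQ[OF Q f kernel]])
  then show "ip_entropy_wrt N M P = sh_entropy_wrt seq_shift M Q"
    by (simp add: sh_entropy_wrt_eq[OF Q f kernel])
qed

lemma sh_entropy_wrt_le:
  assumes Q: "finite_partition M Q"
  shows "sh_entropy_wrt seq_shift M Q \<le> ip_entropy N M"
proof (rule ereal_le_epsilon2)
  fix e :: real assume "0 < e"
  have ln_b: "0 < ln b" using b_gt_1 by simp
  have Q': "finite Q" "Q \<subseteq> events" using Q by (auto simp: finite_partition_def)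
  note cellQ = simple_function_cell[OF Q']
  \<comment> \<open>Dividing by \<open>ln b\<close> expresses the error \<open>e\<close>, measured
    with natural logarithms, in base \<open>b\<close>.\<close>
  have "0 < e / ln b" using ln_b \<open>0 < e\<close> by simp
  then obtain P m where P: "finite_partition N P" and "cond_entropy (cell Q) (name P m) < e / ln b"
    using approximable_cell[OF Q'] unfolding approximable_def by blast
  moreover have "entropy_rate (cell Q) \<le> entropy_rate (name P m) + cond_entropy (cell Q) (name P m)"
    by (rule entropy_rate_le[OF cellQ simple_function_name[OF P]])
  moreover have "entropy_rate (name P m) \<le> entropy_rate (\<lambda>x. cell P (x 0))"
    unfolding name_def by (rule entropy_rate_orbit_word[OF simple_function_cell_coordinate[OF P]])
  ultimately have "entropy_rate (cell Q) \<le> entropy_rate (\<lambda>x. cell P (x 0)) + e / ln b"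
    by linarith
  then have "ln b * entropy_rate (cell Q) \<le> ln b * entropy_rate (\<lambda>x. cell P (x 0)) + e"
    using ln_b by (simp add: field_simps)
  moreover have "sh_entropy_wrt seq_shift M Q = ereal (ln b * entropy_rate (cell Q))"
    by (rule sh_entropy_wrt_eq[OF Q cellQ]) simp
  ultimately have "sh_entropy_wrt seq_shift M Q \<le> ip_entropy_wrt N M P + ereal e"
    by (simp add: ip_entropy_wrt_eq(3)[OF P])
  also have "ip_entropy_wrt N M P \<le> ip_entropy N M"
    unfolding ip_entropy_def using P by (intro SUP_upper) simp
  finally show "sh_entropy_wrt seq_shift M Q \<le> ip_entropy N M + ereal e"
    by (simp add: add_right_mono)
qed

lemma ip_entropy_eq_sh_entropy: "ip_entropy N M = sh_entropy seq_shift M"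
proof (rule antisym)
  show "ip_entropy N M \<le> sh_entropy seq_shift M"
    unfolding ip_entropy_def sh_entropy_def
    \<comment> \<open>Partitions pulled back along coordinate \<open>0\<close> are among all
      partitions of the sequence space.\<close>
    by (rule SUP_mono) (use ip_entropy_wrt_eq(1,2) in auto)
  show "sh_entropy seq_shift M \<le> ip_entropy N M"
    unfolding sh_entropy_def by (rule SUP_least) (simp add: sh_entropy_wrt_le)
qed

end

theorem proposition2p3:
  fixes M :: "'a measure" and \<mu> :: "(nat \<Rightarrow> 'a) measure"
  assumes "prob_space \<mu>"
    and "sets \<mu> = sets (\<Pi>\<^sub>M n\<in>UNIV. M)"
    and "measure_preserving_map \<mu> seq_shift"
  shows "ip_entropy M \<mu> = sh_entropy seq_shift \<mu>"
proof -
  interpret prob_space \<mu> by fact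
  \<comment> \<open>Any base above \<open>1\<close> would serve, as neither entropy in the
    conclusion depends on it.\<close>
  interpret stationary_process \<mu> 2 M
    by unfold_locales (use assms in auto)
  show ?thesis by (rule ip_entropy_eq_sh_entropy)
qed

end
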